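(* Let $f \colon E \longrightarrow F$ be a map of homogeneous type from a Banach lattice $E$ to a Banach space $F$, let $A$ be a subsequence invariant and $\ell_\infty$-complete subset of $\ell_\infty(E)$, and let $\tau$ be a vector topology on $F$ weaker than the norm topology. Consider the sets $$\mathcal{C}_1 =\{(x_j)_{j=1}^\infty \in A : (f(x_j))_{j=1}^\infty \text{ does not converge to } 0 \text{ with respect to } \tau\},$$ $$\mathcal{C}_2 =\{(x_j)_{j=1}^\infty \in A : (x_j)_{j=1}^\infty \text{ is disjoint and } (f(x_j))_{j=1}^\infty \text{ does not converge to } 0 \text{ with respect to } \tau\}.$$ For $i=1,2$, either $\mathcal{C}_i\cap \ell_\infty(E)^{+} = \emptyset$ or $\mathcal{C}_i$ is almost positive pointwise latticeable in $\ell_\infty(E)$.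
   Context: Banach lattices are real. For a Banach lattice $E$, $\ell_\infty(E)$ is the Banach lattice of bounded $E$-valued sequences with the supremum norm and the pointwise ordering; $X^+$ denotes the positive cone of a Banach lattice $X$. A sequence $(x_j)_{j=1}^\infty$ in $E$ is disjoint if $|x_j| \wedge |x_k| = 0$ for $j \neq k$. A Banach sequence lattice is a linear subspace $X$ of $E^{\mathbb{N}}$, $E$ a Banach lattice, endowed with a complete norm that makes $X$ a Banach lattice with the pointwise ordering. A subset $B$ of a Banach sequence lattice $X$ with $B \cap X^+ \neq \emptyset$ is almost positive pointwise latticeable (in $X$) if for each positive sequence $\mathbf{x} \in B$ there exists a closed infinite dimensional sublattice of $X$ contained in $B \cup \{0\}$ and containing a subsequence of $\mathbf{x}$. A map $f \colon E \to F$ between topological vector spaces is of homogeneous type if $f$ is continuous at $0$ and there exists a nonzero integer $n$ such that $f(\lambda x) = \lambda^n f(x)$ for every scalar $\lambda \neq 0$ and every $x \in E$ (Banach spaces are considered with their norm topologies). A subset $A$ of $\ell_\infty(E)$ is subsequence invariant if subsequences of sequences belonging to $A$ belong to $A$; it is $\ell_\infty$-complete if $(\alpha_j x_j)_{j=1}^\infty \in A$ whenever $(x_j)_{j=1}^\infty \in A$ and $(\alpha_j)_{j=1}^\infty \in \ell_\infty$ (bounded scalar sequences). A topology $\tau$ on a linear space $F$ is a vector topology if $(F,\tau)$ is a topological vector space; $\tau$ is weaker than $\tau'$ if $\tau \subseteq \tau'$. *)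

theory Defs
  imports
    "HOL-Analysis.Analysis"
    "HOL-Library.Function_Algebras"
    "HOL-Library.Lattice_Algebras"
    "HOL-Library.Lub_Glb"
begin

class banach_lattice = banach + ordered_real_vector + lattice_ab_group_add_abs +
  assumes norm_lattice_mono: "\<bar>x\<bar> \<le> \<bar>y\<bar> \<Longrightarrow> norm x \<le> norm y"

text \<open>
  Sequences are functions on \<^typ>\<open>nat\<close>. Addition and order are already pointwise on functions;
  the following makes them a real vector space.
\<close>

instantiation "fun" :: (type, real_vector) real_vector
begin

definition scaleR_fun :: "real \<Rightarrow> ('a \<Rightarrow> 'b) \<Rightarrow> 'a \<Rightarrow> 'b"
  where "c *\<^sub>R x = (\<lambda>j. c *\<^sub>R x j)"

instance
  by standard (auto simp: scaleR_fun_def fun_eq_iff scaleR_add_right scaleR_add_left)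

end

text \<open>
  A Banach sequence lattice is given by its underlying set \<open>X\<close> of sequences and its norm \<open>N\<close>,
  whose values outside \<open>X\<close> are irrelevant. Suprema and infima are taken inside \<open>X\<close> with respect to
  the pointwise ordering; they need not be the coordinatewise ones.
\<close>

definition seq_dist :: "(nat \<Rightarrow> 'e) set \<Rightarrow> ((nat \<Rightarrow> 'e) \<Rightarrow> real) \<Rightarrow>
    (nat \<Rightarrow> 'e::banach_lattice) \<Rightarrow> (nat \<Rightarrow> 'e) \<Rightarrow> real"
  where "seq_dist X N x y = (if x \<in> X \<and> y \<in> X then N (x - y) else 0)"

locale banach_sequence_lattice =
  fixes X :: "(nat \<Rightarrow> 'e::banach_lattice) set" and N :: "(nat \<Rightarrow> 'e) \<Rightarrow> real"
  assumes subspace: "subspace X"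
    and norm_nonneg: "x \<in> X \<Longrightarrow> 0 \<le> N x"
    and norm_eq_0: "x \<in> X \<Longrightarrow> N x = 0 \<longleftrightarrow> x = 0"
    and norm_scaleR: "x \<in> X \<Longrightarrow> N (c *\<^sub>R x) = \<bar>c\<bar> * N x"
    and norm_triangle: "x \<in> X \<Longrightarrow> y \<in> X \<Longrightarrow> N (x + y) \<le> N x + N y"
    and complete: "Metric_space.mcomplete X (seq_dist X N)"
    and ex_sup: "x \<in> X \<Longrightarrow> y \<in> X \<Longrightarrow> \<exists>s. isLub X {x, y} s"
    and ex_inf: "x \<in> X \<Longrightarrow> y \<in> X \<Longrightarrow> \<exists>s. isGlb X {x, y} s"
    and norm_mono: "x \<in> X \<Longrightarrow> y \<in> X \<Longrightarrow> isLub X {x, - x} u \<Longrightarrow> isLub X {y, - y} v \<Longrightarrow>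
      u \<le> v \<Longrightarrow> N x \<le> N y"

definition sublattice :: "(nat \<Rightarrow> 'e::banach_lattice) set \<Rightarrow> (nat \<Rightarrow> 'e) set \<Rightarrow> bool"
  where "sublattice X Y \<longleftrightarrow> Y \<subseteq> X \<and> subspace Y \<and>
    (\<forall>x\<in>Y. \<forall>y\<in>Y. \<forall>s. isLub X {x, y} s \<longrightarrow> s \<in> Y) \<and>
    (\<forall>x\<in>Y. \<forall>y\<in>Y. \<forall>s. isGlb X {x, y} s \<longrightarrow> s \<in> Y)"

definition infinite_dimensional :: "'a::real_vector set \<Rightarrow> bool"
  where "infinite_dimensional Y \<longleftrightarrow> \<not> (\<exists>B. finite B \<and> Y \<subseteq> span B)"

definition almost_positive_pointwise_latticeable ::
    "(nat \<Rightarrow> 'e::banach_lattice) set \<Rightarrow> ((nat \<Rightarrow> 'e) \<Rightarrow> real) \<Rightarrow> (nat \<Rightarrow> 'e) set \<Rightarrow> bool"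
  where "almost_positive_pointwise_latticeable X N B \<longleftrightarrow>
    B \<subseteq> X \<and> B \<inter> {x \<in> X. 0 \<le> x} \<noteq> {} \<and>
    (\<forall>x \<in> B \<inter> {x \<in> X. 0 \<le> x}. \<exists>Y.
      sublattice X Y \<and>
      closedin (Metric_space.mtopology X (seq_dist X N)) Y \<and>
      infinite_dimensional Y \<and>
      Y \<subseteq> B \<union> {0} \<and>
      (\<exists>r. strict_mono r \<and> x \<circ> r \<in> Y))"

definition linf :: "(nat \<Rightarrow> 'e::real_normed_vector) set"
  where "linf = {x. bounded (range x)}"

definition linf_norm :: "(nat \<Rightarrow> 'e::real_normed_vector) \<Rightarrow> real"
  where "linf_norm x = (SUP j. norm (x j))"

definition disjoint_sequence :: "(nat \<Rightarrow> 'e::banach_lattice) \<Rightarrow> bool"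
  where "disjoint_sequence x \<longleftrightarrow> (\<forall>j k. j \<noteq> k \<longrightarrow> inf \<bar>x j\<bar> \<bar>x k\<bar> = 0)"

definition homogeneous_type :: "('e::real_normed_vector \<Rightarrow> 'f::real_normed_vector) \<Rightarrow> bool"
  where "homogeneous_type f \<longleftrightarrow> isCont f 0 \<and>
    (\<exists>n::int. n \<noteq> 0 \<and> (\<forall>c x. c \<noteq> 0 \<longrightarrow> f (c *\<^sub>R x) = (c powi n) *\<^sub>R f x))"

definition subsequence_invariant :: "(nat \<Rightarrow> 'e) set \<Rightarrow> bool"
  where "subsequence_invariant A \<longleftrightarrow> (\<forall>x\<in>A. \<forall>r. strict_mono r \<longrightarrow> x \<circ> r \<in> A)"

definition linf_complete :: "(nat \<Rightarrow> 'e::real_vector) set \<Rightarrow> bool"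
  where "linf_complete A \<longleftrightarrow> (\<forall>x\<in>A. \<forall>a\<in>(linf :: (nat \<Rightarrow> real) set). (\<lambda>j. a j *\<^sub>R x j) \<in> A)"

text \<open>A topological vector space is not required to be Hausdorff.\<close>

definition vector_topology :: "'f::real_vector topology \<Rightarrow> bool"
  where "vector_topology \<tau> \<longleftrightarrow> topspace \<tau> = UNIV \<and>
    continuous_map (prod_topology \<tau> \<tau>) \<tau> (\<lambda>(x, y). x + y) \<and>
    continuous_map (prod_topology euclideanreal \<tau>) \<tau> (\<lambda>(c, x). c *\<^sub>R x)"

definition weaker_topology :: "'a topology \<Rightarrow> 'a topology \<Rightarrow> bool"
  where "weaker_topology \<tau> \<tau>' \<longleftrightarrow> (\<forall>U. openin \<tau> U \<longrightarrow> openin \<tau>' U)"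

lemma bdd_above_linf: "x \<in> linf \<Longrightarrow> bdd_above (range (\<lambda>j. norm (x j)))"
  by (auto simp: linf_def bounded_iff bdd_above_def)

lemma linf_norm_upper: "x \<in> linf \<Longrightarrow> norm (x j) \<le> linf_norm x"
  unfolding linf_norm_def by (rule cSUP_upper[OF _ bdd_above_linf]) auto

lemma linf_norm_least: "(\<And>j. norm (x j) \<le> c) \<Longrightarrow> linf_norm x \<le> c"
  unfolding linf_norm_def by (rule cSUP_least) auto

lemma linfI: "(\<And>j. norm (x j) \<le> c) \<Longrightarrow> x \<in> linf"
  by (auto simp: linf_def bounded_iff)

lemma subspace_linf: "subspace (linf :: (nat \<Rightarrow> 'e::real_normed_vector) set)"
proof (rule subspaceI)
  show "(0 :: nat \<Rightarrow> 'e) \<in> linf"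
    by (rule linfI[of _ 0]) simp
next
  fix x y :: "nat \<Rightarrow> 'e" assume "x \<in> linf" "y \<in> linf"
  then show "x + y \<in> linf"
    by (intro linfI[of _ "linf_norm x + linf_norm y"])
       (auto intro!: norm_triangle_mono linf_norm_upper)
next
  fix c and x :: "nat \<Rightarrow> 'e" assume "x \<in> linf"
  then show "c *\<^sub>R x \<in> linf"
    by (intro linfI[of _ "\<bar>c\<bar> * linf_norm x"])
       (auto simp: scaleR_fun_def intro!: mult_left_mono linf_norm_upper)
qed

lemma norm_sup_le: "norm (sup x y) \<le> norm x + 2 * norm (y::'e::banach_lattice)"
proof -
  have *: "norm (pprt a) \<le> norm a" for a :: 'e
    by (rule norm_lattice_mono) (metis abs_of_nonneg abs_prts add_increasing2
      diff_conv_add_uminus neg_0_le_iff_le nprt_le_zero order_refl zero_le_pprt)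
  have "sup x y = y + pprt (x - y)"
    by (simp add: pprt_def add_sup_distrib_left)
  then have "norm (sup x y) \<le> norm y + norm (x - y)"
    by (metis * add_left_mono norm_triangle_le)
  then show ?thesis
    using norm_triangle_ineq4[of x y] by linarith
qed

lemma sup_in_linf: "x \<in> linf \<Longrightarrow> y \<in> linf \<Longrightarrow> sup x y \<in> linf"
  for x y :: "nat \<Rightarrow> 'e::banach_lattice"
proof (rule linfI)
  fix j assume "x \<in> linf" "y \<in> linf"
  then show "norm (sup x y j) \<le> linf_norm x + 2 * linf_norm y"
    using norm_sup_le[of "x j" "y j"] linf_norm_upper[of x j] linf_norm_upper[of y j]
    by (simp add: sup_fun_def)
qed

lemma uminus_in_linf: "x \<in> linf \<Longrightarrow> - x \<in> linf"
  for x :: "nat \<Rightarrow> 'e::banach_lattice"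
  by (rule subspace_neg[OF subspace_linf])

lemma inf_in_linf: "x \<in> linf \<Longrightarrow> y \<in> linf \<Longrightarrow> inf x y \<in> linf"
  for x y :: "nat \<Rightarrow> 'e::banach_lattice"
proof -
  assume "x \<in> linf" "y \<in> linf"
  moreover have "inf x y = - sup (- x) (- y)"
    by (simp add: fun_eq_iff inf_fun_def sup_fun_def neg_sup_eq_inf)
  ultimately show ?thesis
    by (simp add: sup_in_linf uminus_in_linf)
qed

lemma isLub_linf_iff: "x \<in> linf \<Longrightarrow> y \<in> linf \<Longrightarrow> isLub linf {x, y} s \<longleftrightarrow> s = sup x y"
  for x y :: "nat \<Rightarrow> 'e::banach_lattice"
  by (auto simp: isLub_def leastP_def isUb_def setle_def setge_def sup_in_linf intro!: antisym)

lemma isGlb_linf_iff: "x \<in> linf \<Longrightarrow> y \<in> linf \<Longrightarrow> isGlb linf {x, y} s \<longleftrightarrow> s = inf x y"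
  for x y :: "nat \<Rightarrow> 'e::banach_lattice"
  by (auto simp: isGlb_def greatestP_def isLb_def setle_def setge_def inf_in_linf intro!: antisym)

lemma linf_norm_nonneg: "x \<in> linf \<Longrightarrow> 0 \<le> linf_norm x"
  using linf_norm_upper[of x 0] norm_ge_zero[of "x 0"] by linarith

lemma linf_norm_eq_0: "x \<in> linf \<Longrightarrow> linf_norm x = 0 \<longleftrightarrow> x = 0"
proof
  assume "x \<in> linf" "linf_norm x = 0"
  then show "x = 0"
    using linf_norm_upper[of x] by (auto simp: fun_eq_iff)
qed (simp add: linf_norm_def)

lemma linf_norm_triangle:
  "x \<in> linf \<Longrightarrow> y \<in> linf \<Longrightarrow> linf_norm (x + y) \<le> linf_norm x + linf_norm y"
  by (rule linf_norm_least) (auto intro!: norm_triangle_mono linf_norm_upper)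

lemma linf_norm_scaleR: "x \<in> linf \<Longrightarrow> linf_norm (c *\<^sub>R x) = \<bar>c\<bar> * linf_norm x"
proof (rule antisym)
  assume x: "x \<in> linf"
  then show "linf_norm (c *\<^sub>R x) \<le> \<bar>c\<bar> * linf_norm x"
    by (intro linf_norm_least) (auto simp: scaleR_fun_def intro!: mult_left_mono linf_norm_upper)
  show "\<bar>c\<bar> * linf_norm x \<le> linf_norm (c *\<^sub>R x)"
  proof (cases "c = 0")
    case False
    have "c *\<^sub>R x \<in> linf"
      using subspace_linf x by (rule subspace_scale)
    then have "norm (x j) \<le> linf_norm (c *\<^sub>R x) / \<bar>c\<bar>" for j
      using linf_norm_upper[of "c *\<^sub>R x" j] False
      by (simp add: scaleR_fun_def field_simps)
    then have "linf_norm x \<le> linf_norm (c *\<^sub>R x) / \<bar>c\<bar>"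
      by (rule linf_norm_least)
    then show ?thesis
      using False by (simp add: field_simps)
  qed (simp add: linf_norm_def scaleR_fun_def)
qed

lemma Metric_space_linf:
  "Metric_space (linf :: (nat \<Rightarrow> 'e::banach_lattice) set) (seq_dist linf linf_norm)"
proof
  fix x y z :: "nat \<Rightarrow> 'e"
  have diff: "u - v \<in> linf" if "u \<in> linf" "v \<in> linf" for u v :: "nat \<Rightarrow> 'e"
    using subspace_linf that by (rule subspace_diff)
  show "0 \<le> seq_dist linf linf_norm x y"
    by (simp add: seq_dist_def linf_norm_nonneg diff)
  show "seq_dist linf linf_norm x y = seq_dist linf linf_norm y x"
    by (simp add: seq_dist_def linf_norm_def norm_minus_commute)
  show "seq_dist linf linf_norm x y = 0 \<longleftrightarrow> x = y" if "x \<in> linf" "y \<in> linf"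
    using that by (simp add: seq_dist_def linf_norm_eq_0 diff)
  show "seq_dist linf linf_norm x z \<le> seq_dist linf linf_norm x y + seq_dist linf linf_norm y z"
    if "x \<in> linf" "y \<in> linf" "z \<in> linf"
    using that linf_norm_triangle[OF diff[of x y] diff[of y z]] by (simp add: seq_dist_def)
qed

lemma mcomplete_linf:
  "Metric_space.mcomplete (linf :: (nat \<Rightarrow> 'e::banach_lattice) set) (seq_dist linf linf_norm)"
proof -
  interpret Metric_space "linf :: (nat \<Rightarrow> 'e) set" "seq_dist linf linf_norm"
    by (rule Metric_space_linf)
  have "\<exists>l. limitin mtopology s l sequentially" if C: "MCauchy s" for s :: "nat \<Rightarrow> nat \<Rightarrow> 'e"
  proof -
    have s: "s n \<in> linf" for n
      using C by (auto simp: MCauchy_def)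
    have diff: "s m - s n \<in> linf" for m n
      using subspace_linf s s by (rule subspace_diff)
    have unif: "\<exists>N. \<forall>m\<ge>N. \<forall>n\<ge>N. \<forall>j. norm (s m j - s n j) < e" if "e > 0" for e
    proof -
      from C that obtain N where N: "seq_dist linf linf_norm (s m) (s n) < e"
        if "m \<ge> N" "n \<ge> N" for m n
        unfolding MCauchy_def by metis
      show ?thesis
      proof (intro exI allI impI)
        fix m n j assume "N \<le> m" "N \<le> n"
        then show "norm (s m j - s n j) < e"
          using N[of m n] linf_norm_upper[OF diff[of m n], of j] by (simp add: seq_dist_def s)
      qed
    qed
    have "Cauchy (\<lambda>n. s n j)" for j
      unfolding Cauchy_iff using unif by blast
    then have "\<forall>j. \<exists>l. (\<lambda>n. s n j) \<longlonglongrightarrow> l"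
      by (simp add: Cauchy_convergent_iff convergent_def)
    then obtain l where l: "(\<lambda>n. s n j) \<longlonglongrightarrow> l j" for j
      by metis
    have close: "\<exists>N. \<forall>m\<ge>N. \<forall>j. norm (s m j - l j) \<le> e" if "e > 0" for e
    proof -
      from unif[OF that] obtain N where N: "norm (s m j - s n j) < e" if "m \<ge> N" "n \<ge> N" for m n j
        by blast
      have "norm (s m j - l j) \<le> e" if m: "m \<ge> N" for m j
      proof (rule tendsto_upperbound)
        show "(\<lambda>n. norm (s m j - s n j)) \<longlonglongrightarrow> norm (s m j - l j)"
          by (intro tendsto_intros l)
        show "\<forall>\<^sub>F n in sequentially. norm (s m j - s n j) \<le> e"
          unfolding eventually_sequentially using N[OF m] by (intro exI[of _ N]) (auto intro: less_imp_le)
      qed simp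
      then show ?thesis by blast
    qed
    from close[of 1] obtain N where N: "norm (s N j - l j) \<le> 1" for j
      by auto
    have l_in: "l \<in> linf"
    proof (rule linfI)
      fix j
      have "norm (l j) \<le> norm (s N j) + norm (s N j - l j)"
        by (metis norm_minus_commute norm_triangle_sub)
      then show "norm (l j) \<le> linf_norm (s N) + 1"
        using linf_norm_upper[OF s, of N j] N[of j] by linarith
    qed
    have "limitin mtopology s l sequentially"
      unfolding limit_metric_sequentially
    proof (intro conjI allI impI l_in)
      fix e :: real assume "e > 0"
      with close[of "e/2"] obtain N where N: "norm (s m j - l j) \<le> e/2" if "m \<ge> N" for m j
        by auto
      have "linf_norm (s m - l) < e" if "m \<ge> N" for m
        using linf_norm_least[of "s m - l" "e/2"] N[OF that] \<open>e > 0\<close> by fastforce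
      then show "\<exists>N. \<forall>n\<ge>N. s n \<in> linf \<and> seq_dist linf linf_norm (s n) l < e"
        by (auto simp: seq_dist_def s l_in)
    qed
    then show ?thesis by blast
  qed
  then show ?thesis
    by (simp add: mcomplete_def)
qed

lemma banach_sequence_lattice_linf:
  "banach_sequence_lattice (linf :: (nat \<Rightarrow> 'e::banach_lattice) set) linf_norm"
proof
  fix x y u v :: "nat \<Rightarrow> 'e"
  assume xy: "x \<in> linf" "y \<in> linf" and "isLub linf {x, - x} u" "isLub linf {y, - y} v" "u \<le> v"
  then have "\<bar>x j\<bar> \<le> \<bar>y j\<bar>" for j
    by (auto simp: isLub_linf_iff uminus_in_linf abs_lattice sup_fun_def le_fun_def)
  then show "linf_norm x \<le> linf_norm y"
    using order_trans[OF norm_lattice_mono linf_norm_upper[OF xy(2)]]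
    by (intro linf_norm_least) blast
qed (simp_all add: subspace_linf linf_norm_nonneg linf_norm_eq_0 linf_norm_scaleR
    linf_norm_triangle mcomplete_linf isLub_linf_iff isGlb_linf_iff)

end

theory Submission
  imports Defs
begin

text \<open>
  Let \<open>x\<close> be a positive sequence in \<open>C\<^sub>i\<close>. Some \<open>\<tau>\<close>-neighbourhood \<open>U\<close> of \<open>0\<close> is missed by \<open>f (x j)\<close> for
  infinitely many \<open>j\<close>; let \<open>z\<close> be the subsequence of \<open>x\<close> along these indices. Homogeneity forces
  \<open>f 0 = 0\<close>, so continuity of \<open>f\<close> at \<open>0\<close>, together with the fact that \<open>U\<close> is norm-open, keeps the
  norms of the \<open>z k\<close> away from \<open>0\<close>.

  Partition the indices into infinitely many infinite blocks, recorded by a function \<open>p\<close> sending an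
  index to its block, and let \<open>Y\<close> consist of the bounded sequences obtained from \<open>z\<close> by multiplying
  all terms of a block by a scalar depending only on that block. One scalar for all blocks gives \<open>z\<close>
  itself, so \<open>Y\<close> contains a subsequence of \<open>x\<close>; having infinitely many blocks makes \<open>Y\<close> infinite
  dimensional; and \<open>Y\<close> is a closed sublattice, since on a line through a positive nonzero vector the
  lattice operations and the limits are those of the scalars (\<open>sublattice_blockwise_multiples\<close>,
  \<open>closedin_blockwise_multiples\<close>).

  It remains to see that nonzero elements of \<open>Y\<close> lie in \<open>C\<^sub>i\<close>. The lower bound on the norms makes the
  multipliers bounded, so membership in \<open>A\<close> follows from completeness of \<open>A\<close>. A nonzero element has
  a nonzero multiplier \<open>c\<close> on some block, and there \<open>f\<close> takes the values \<open>c\<^sup>n\<close> times \<open>f (z k)\<close>;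
  as the block is infinite and multiplication by \<open>c\<^sup>-\<^sup>n\<close> is \<open>\<tau>\<close>-continuous, convergence to \<open>0\<close> would put
  some \<open>f (z k)\<close> into \<open>U\<close> (\<open>not_limitin_blockwise_multiple\<close>).
\<close>

section \<open>Multiples of a positive vector\<close>

lemma sup_scaleR_nonneg:
  fixes x :: "'e::banach_lattice"
  assumes "0 \<le> x"
  shows "sup (a *\<^sub>R x) (b *\<^sub>R x) = max a b *\<^sub>R x"
proof (cases "a \<le> b")
  case True
  then show ?thesis
    using scaleR_right_mono[OF True assms] by (simp add: sup_absorb2 max_absorb2)
next
  case False
  then show ?thesis
    using scaleR_right_mono[of b a x] assms by (simp add: sup_absorb1 max_absorb1)
qed

lemma inf_scaleR_nonneg:
  fixes x :: "'e::banach_lattice"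
  assumes "0 \<le> x"
  shows "inf (a *\<^sub>R x) (b *\<^sub>R x) = min a b *\<^sub>R x"
proof (cases "a \<le> b")
  case True
  then show ?thesis
    using scaleR_right_mono[OF True assms] by (simp add: inf_absorb1 min_absorb1)
next
  case False
  then show ?thesis
    using scaleR_right_mono[of b a x] assms by (simp add: inf_absorb2 min_absorb2)
qed

lemma abs_scaleR_le:
  fixes x :: "'e::banach_lattice"
  assumes "0 \<le> x" and "\<bar>a\<bar> \<le> m"
  shows "\<bar>a *\<^sub>R x\<bar> \<le> m *\<^sub>R x"
proof -
  have "a *\<^sub>R x \<le> m *\<^sub>R x" "(- a) *\<^sub>R x \<le> m *\<^sub>R x"
    by (rule scaleR_right_mono; use assms in linarith)+
  then show ?thesis
    by (simp add: abs_lattice)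
qed

lemma disjoint_sequence_scaleR:
  fixes x :: "nat \<Rightarrow> 'e::banach_lattice"
  assumes x: "disjoint_sequence x" and pos: "\<And>k. 0 \<le> x k"
  shows "disjoint_sequence (\<lambda>k. a k *\<^sub>R x k)"
  unfolding disjoint_sequence_def
proof (intro allI impI)
  fix j k :: nat assume "j \<noteq> k"
  then have dis: "inf (x j) (x k) = 0"
    using x pos by (simp add: disjoint_sequence_def)
  \<comment> \<open>Adding \<open>1\<close> makes the common bound of the two scalars invertible.\<close>
  define m where "m = max \<bar>a j\<bar> \<bar>a k\<bar> + 1"
  have m: "m > 0"
    by (simp add: m_def)
  let ?w = "inf \<bar>a j *\<^sub>R x j\<bar> \<bar>a k *\<^sub>R x k\<bar>"
  have "\<bar>a j *\<^sub>R x j\<bar> \<le> m *\<^sub>R x j" "\<bar>a k *\<^sub>R x k\<bar> \<le> m *\<^sub>R x k"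
    by (auto simp: m_def intro!: abs_scaleR_le pos)
  then have bound: "?w \<le> m *\<^sub>R x j" "?w \<le> m *\<^sub>R x k"
    by (auto intro: le_infI1 le_infI2)
  have "inverse m *\<^sub>R ?w \<le> x i" if "?w \<le> m *\<^sub>R x i" for i
    using scaleR_left_mono[OF that, of "inverse m"] m by simp
  then have "inverse m *\<^sub>R ?w \<le> 0"
    using bound dis by (metis le_inf_iff)
  then have "?w \<le> 0"
    using scaleR_left_mono[of "inverse m *\<^sub>R ?w" 0 m] m by simp
  then show "?w = 0"
    by (simp add: antisym)
qed

section \<open>Blockwise multiples of a sequence\<close>

text \<open>The index \<open>k\<close> belongs to the block numbered \<open>p k\<close>. Boundedness is required of the sequence
  and not of the multipliers, so that closedness only concerns the coordinates.\<close>

definition blockwise_multiples :: "(nat \<Rightarrow> nat) \<Rightarrow> (nat \<Rightarrow> 'e::real_normed_vector) \<Rightarrow> (nat \<Rightarrow> 'e) set"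
  where "blockwise_multiples p x = {y \<in> linf. \<exists>a. \<forall>k. y k = a (p k) *\<^sub>R x k}"

lemma subspace_blockwise_multiples:
  fixes x :: "nat \<Rightarrow> 'e::banach_lattice"
  shows "subspace (blockwise_multiples p x)"
proof (rule subspaceI)
  show "0 \<in> blockwise_multiples p x"
    using subspace_0[OF subspace_linf]
    by (auto simp: blockwise_multiples_def intro!: exI[of _ "\<lambda>_. 0"])
next
  fix u v assume "u \<in> blockwise_multiples p x" "v \<in> blockwise_multiples p x"
  then obtain a b where "u \<in> linf" "v \<in> linf"
    "\<And>k. u k = a (p k) *\<^sub>R x k" "\<And>k. v k = b (p k) *\<^sub>R x k"
    by (auto simp: blockwise_multiples_def)
  then show "u + v \<in> blockwise_multiples p x"
    using subspace_add[OF subspace_linf]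
    by (auto simp: blockwise_multiples_def scaleR_add_left intro!: exI[of _ "\<lambda>i. a i + b i"])
next
  fix c u assume "u \<in> blockwise_multiples p x"
  then obtain a where "u \<in> linf" "\<And>k. u k = a (p k) *\<^sub>R x k"
    by (auto simp: blockwise_multiples_def)
  then show "c *\<^sub>R u \<in> blockwise_multiples p x"
    using subspace_scale[OF subspace_linf, of u c]
    by (auto simp: blockwise_multiples_def scaleR_fun_def intro!: exI[of _ "\<lambda>i. c * a i"])
qed

lemma sublattice_blockwise_multiples:
  fixes x :: "nat \<Rightarrow> 'e::banach_lattice"
  assumes pos: "\<And>k. 0 \<le> x k"
  shows "sublattice linf (blockwise_multiples p x)"
proof -
  have "sup u v \<in> blockwise_multiples p x \<and> inf u v \<in> blockwise_multiples p x"
    if uv: "u \<in> blockwise_multiples p x" "v \<in> blockwise_multiples p x" for u v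
  proof -
    obtain a b where linf: "u \<in> linf" "v \<in> linf"
      and eq: "\<And>k. u k = a (p k) *\<^sub>R x k" "\<And>k. v k = b (p k) *\<^sub>R x k"
      using uv by (auto simp: blockwise_multiples_def)
    have "sup u v k = max (a (p k)) (b (p k)) *\<^sub>R x k"
      "inf u v k = min (a (p k)) (b (p k)) *\<^sub>R x k" for k
      by (simp_all add: eq pos sup_scaleR_nonneg inf_scaleR_nonneg)
    then show ?thesis
      using sup_in_linf[OF linf] inf_in_linf[OF linf]
      by (auto simp: blockwise_multiples_def simp del: sup_apply inf_apply
          intro: exI[of _ "\<lambda>i. max (a i) (b i)"] exI[of _ "\<lambda>i. min (a i) (b i)"])
  qed
  moreover have "blockwise_multiples p x \<subseteq> linf"
    by (auto simp: blockwise_multiples_def)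
  ultimately show ?thesis
    unfolding sublattice_def
    by (auto simp: subspace_blockwise_multiples isLub_linf_iff isGlb_linf_iff subset_iff)
qed

text \<open>Convergence in norm implies convergence of each coordinate, and in a coordinate \<open>k\<close> it is
  convergence of the multipliers of the block of \<open>k\<close>, because \<open>x k \<noteq> 0\<close>. The limiting multiplier
  is computed from the multipliers alone, hence is the same for all coordinates of a block.\<close>

lemma closedin_blockwise_multiples:
  fixes x :: "nat \<Rightarrow> 'e::banach_lattice"
  assumes nz: "\<And>k. x k \<noteq> 0"
  shows "closedin (Metric_space.mtopology linf (seq_dist linf linf_norm)) (blockwise_multiples p x)"
proof -
  interpret Metric_space "linf :: (nat \<Rightarrow> 'e) set" "seq_dist linf linf_norm"
    by (rule Metric_space_linf)
  have "y \<in> blockwise_multiples p x"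
    if s: "range s \<subseteq> blockwise_multiples p x" and lim: "limitin mtopology s y sequentially" for s y
  proof -
    have sB: "s m \<in> blockwise_multiples p x" for m
      using s by auto
    then have s_linf: "s m \<in> linf" for m
      by (auto simp: blockwise_multiples_def)
    have "\<forall>m. \<exists>a. \<forall>k. s m k = a (p k) *\<^sub>R x k"
      using sB by (auto simp: blockwise_multiples_def)
    then obtain a where a: "\<And>m k. s m k = a m (p k) *\<^sub>R x k"
      by metis
    have y: "y \<in> linf"
      using lim by (auto simp: limit_metric_sequentially)
    have coord: "(\<lambda>m. s m k) \<longlonglongrightarrow> y k" for k
    proof (rule LIMSEQ_I)
      fix e :: real assume "e > 0"
      then obtain M where M: "\<And>m. m \<ge> M \<Longrightarrow> seq_dist linf linf_norm (s m) y < e"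
        using lim unfolding limit_metric_sequentially by blast
      have "norm (s m k - y k) < e" if "m \<ge> M" for m
        using M[OF that] linf_norm_upper[OF subspace_diff[OF subspace_linf s_linf[of m] y], of k]
        by (simp add: seq_dist_def s_linf y)
      then show "\<exists>M. \<forall>m\<ge>M. norm (s m k - y k) < e"
        by blast
    qed
    have conv: "convergent (\<lambda>m. a m (p k))" for k
    proof -
      have "Cauchy (\<lambda>m. a m (p k))"
      proof (rule CauchyI)
        fix e :: real assume "e > 0"
        then have "e * norm (x k) > 0"
          using nz by simp
        then obtain M where M: "\<And>m l. m \<ge> M \<Longrightarrow> l \<ge> M \<Longrightarrow> norm (s m k - s l k) < e * norm (x k)"
          using LIMSEQ_imp_Cauchy[OF coord[of k]] unfolding Cauchy_iff by blast
        have "norm (a m (p k) - a l (p k)) < e" if "m \<ge> M" "l \<ge> M" for m l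
          using M[OF that] nz[of k] by (simp add: a flip: scaleR_diff_left)
        then show "\<exists>M. \<forall>m\<ge>M. \<forall>l\<ge>M. norm (a m (p k) - a l (p k)) < e"
          by blast
      qed
      then show ?thesis
        by (rule Cauchy_convergent)
    qed
    define c where "c i = lim (\<lambda>m. a m i)" for i
    have "(\<lambda>m. s m k) \<longlonglongrightarrow> c (p k) *\<^sub>R x k" for k
      unfolding a c_def using conv[of k]
      by (intro tendsto_intros) (simp add: convergent_LIMSEQ_iff)
    then have "y k = c (p k) *\<^sub>R x k" for k
      using coord LIMSEQ_unique by blast
    then show ?thesis
      using y by (auto simp: blockwise_multiples_def)
  qed
  moreover have "blockwise_multiples p x \<subseteq> linf"
    by (auto simp: blockwise_multiples_def)
  ultimately show ?thesis
    unfolding metric_closedin_iff_sequentially_closed by blast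
qed

text \<open>The restrictions of \<open>x\<close> to the single blocks are linearly independent, since each of them is
  nonzero at an index where all the others vanish.\<close>

lemma infinite_dimensional_blockwise_multiples:
  fixes x :: "nat \<Rightarrow> 'e::banach_lattice"
  assumes x: "x \<in> linf" and nz: "\<And>k. x k \<noteq> 0" and p: "surj p"
  shows "infinite_dimensional (blockwise_multiples p x)"
proof -
  define e where "e i = (\<lambda>k. (if p k = i then 1 else 0 :: real) *\<^sub>R x k)" for i
  have e: "e i \<in> blockwise_multiples p x" for i
  proof -
    have "e i \<in> linf"
      by (rule linfI[of _ "linf_norm x"])
        (simp add: e_def linf_norm_upper[OF x] linf_norm_nonneg[OF x])
    then show ?thesis
      by (auto simp: blockwise_multiples_def e_def intro!: exI[of _ "\<lambda>j. if j = i then 1 else 0"])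
  qed
  obtain q where q: "\<And>i. p (q i) = i"
    using p by (metis surjD)
  have e_q: "e i (q i) \<noteq> 0" "j \<noteq> i \<Longrightarrow> e j (q i) = 0" for i j
    by (auto simp: e_def q nz)
  have "inj e"
    by (rule injI) (metis e_q)
  have "independent (range e)"
    unfolding dependent_def
  proof clarify
    fix i assume span: "e i \<in> span (range e - {e i})"
    have "subspace {y :: nat \<Rightarrow> 'e. y (q i) = 0}"
      by (rule subspaceI) (auto simp: scaleR_fun_def)
    moreover have "range e - {e i} \<subseteq> {y. y (q i) = 0}"
    proof clarsimp
      fix j assume "e j \<noteq> e i"
      then show "e j (q i) = 0"
        by (intro e_q(2)) auto
    qed
    ultimately have "e i \<in> {y. y (q i) = 0}"
      using span span_minimal by blast
    then show False
      using e_q(1) by simp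
  qed
  moreover have "infinite (range e)"
    using \<open>inj e\<close> by (simp add: finite_image_iff)
  ultimately show ?thesis
    unfolding infinite_dimensional_def using e independent_span_bound
    by (metis image_subset_iff subset_trans)
qed

lemma bounded_multipliers:
  fixes x :: "nat \<Rightarrow> 'e::real_normed_vector"
  assumes y: "y \<in> linf" and eq: "\<And>k. y k = a k *\<^sub>R x k"
    and "\<delta> > 0" and low: "\<And>k. \<delta> \<le> norm (x k)"
  shows "a \<in> linf"
proof (rule linfI)
  fix k
  have "\<bar>a k\<bar> * \<delta> \<le> \<bar>a k\<bar> * norm (x k)"
    by (rule mult_left_mono) (use low in auto)
  also have "\<dots> \<le> linf_norm y"
    using linf_norm_upper[OF y, of k] by (simp add: eq)
  finally show "norm (a k) \<le> linf_norm y / \<delta>"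
    using \<open>\<delta> > 0\<close> by (simp add: field_simps)
qed

section \<open>Maps of homogeneous type and vector topologies\<close>

text \<open>Scaling \<open>0\<close> by \<open>2\<close> gives \<open>f 0 = 2\<^sup>n f 0\<close>, where \<open>2\<^sup>n \<noteq> 1\<close>.\<close>

lemma homogeneous_type_0:
  assumes "homogeneous_type f"
  shows "f 0 = 0"
proof -
  obtain n :: int where n: "n \<noteq> 0" and f: "\<And>c x. c \<noteq> 0 \<Longrightarrow> f (c *\<^sub>R x) = (c powi n) *\<^sub>R f x"
    using assms by (auto simp: homogeneous_type_def)
  have "(2::real) ^ nat n \<noteq> 1" if "n > 0"
    using one_less_power[of "2::real" "nat n"] that by linarith
  moreover have "(2::real) ^ nat (- n) \<noteq> 1" if "n < 0"
    using one_less_power[of "2::real" "nat (- n)"] that by linarith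
  ultimately have "(2::real) powi n \<noteq> 1"
    using n by (auto simp: power_int_def power_one_over)
  moreover have "(2 powi n - 1) *\<^sub>R f 0 = 0"
    using f[of 2 0] by (simp add: scaleR_diff_left)
  ultimately show ?thesis
    by simp
qed

lemma homogeneous_type_bounded_below:
  assumes f: "homogeneous_type f" and "open U" "0 \<in> U"
  obtains \<delta> where "\<delta> > 0" "\<And>x. f x \<notin> U \<Longrightarrow> \<delta> \<le> norm x"
proof -
  have "isCont f 0" "f 0 = 0"
    using f homogeneous_type_0 by (auto simp: homogeneous_type_def)
  then have "\<forall>\<^sub>F x in nhds 0. f x \<in> U"
    using assms by (metis isCont_def tendsto_at_iff_tendsto_nhds topological_tendstoD)
  then obtain \<delta> where "\<delta> > 0" "\<And>x. dist x 0 < \<delta> \<Longrightarrow> f x \<in> U"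
    unfolding eventually_nhds_metric by blast
  then show ?thesis
    by (intro that[of \<delta>]) (auto simp: not_less[symmetric])
qed

lemma vector_topology_limitin_scaleR:
  assumes \<tau>: "vector_topology \<tau>" and g: "limitin \<tau> g l F"
  shows "limitin \<tau> (\<lambda>k. c *\<^sub>R g k) (c *\<^sub>R l) F"
proof -
  have "continuous_map \<tau> (prod_topology euclideanreal \<tau>) (\<lambda>z. (c, z))"
    by (intro continuous_map_pairedI) auto
  then have "continuous_map \<tau> \<tau> ((\<lambda>(c, x). c *\<^sub>R x) \<circ> (\<lambda>z. (c, z)))"
    using \<tau> by (auto simp: vector_topology_def intro: continuous_map_compose)
  from continuous_map_limit[OF this g] show ?thesis
    by (simp add: o_def)
qed

lemma subsequence_avoiding_neighbourhood:
  assumes \<tau>: "vector_topology \<tau>" and g: "\<not> limitin \<tau> g 0 sequentially"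
  obtains U and r :: "nat \<Rightarrow> nat" where "openin \<tau> U" "0 \<in> U" "strict_mono r" "\<And>k. g (r k) \<notin> U"
proof -
  obtain U where U: "openin \<tau> U" "0 \<in> U" and ev: "\<not> (\<forall>\<^sub>F j in sequentially. g j \<in> U)"
    using \<tau> g by (auto simp: limitin_def vector_topology_def)
  from ev have inf: "infinite {j. g j \<notin> U}"
    by (simp add: cofinite_eq_sequentially[symmetric] eventually_cofinite)
  show ?thesis
    by (rule that[OF U strict_mono_enumerate[OF inf]]) (use enumerate_in_set[OF inf] in auto)
qed

text \<open>Along an infinite block with multiplier \<open>c \<noteq> 0\<close> the values of \<open>f\<close> are \<open>c\<^sup>n\<close> times those on \<open>x\<close>,
  and a vector topology permits dividing a limit by \<open>c\<^sup>n\<close>.\<close>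

lemma not_limitin_blockwise_multiple:
  assumes f: "homogeneous_type f" and \<tau>: "vector_topology \<tau>"
    and U: "openin \<tau> U" "0 \<in> U" and avoid: "\<And>k. f (x k) \<notin> U"
    and inf: "infinite {k. p k = i}" and a: "a i \<noteq> 0"
  shows "\<not> limitin \<tau> (\<lambda>k. f (a (p k) *\<^sub>R x k)) 0 sequentially"
proof
  assume lim: "limitin \<tau> (\<lambda>k. f (a (p k) *\<^sub>R x k)) 0 sequentially"
  obtain n :: int where n: "\<And>c x. c \<noteq> 0 \<Longrightarrow> f (c *\<^sub>R x) = (c powi n) *\<^sub>R f x"
    using f by (auto simp: homogeneous_type_def)
  define q where "q = enumerate {k. p k = i}"
  have q: "strict_mono q" "\<And>k. p (q k) = i"
    using strict_mono_enumerate[OF inf] enumerate_in_set[OF inf] by (auto simp: q_def)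
  have "limitin \<tau> (\<lambda>k. (a i powi n) *\<^sub>R f (x (q k))) 0 sequentially"
    using limitin_subsequence[OF q(1) lim] by (simp add: o_def q n[OF a])
  from vector_topology_limitin_scaleR[OF \<tau> this, of "inverse (a i powi n)"]
  have "limitin \<tau> (\<lambda>k. f (x (q k))) 0 sequentially"
    using a by simp
  then have "\<forall>\<^sub>F k in sequentially. f (x (q k)) \<in> U"
    using U by (auto simp: limitin_def)
  then show False
    using avoid by simp
qed

section \<open>Latticeability of nonconvergence\<close>

text \<open>The set \<open>D\<close> treats both sets at once: it is the set of all sequences for \<open>C\<^sub>1\<close>, the set of
  disjoint sequences for \<open>C\<^sub>2\<close>.\<close>

lemma almost_positive_pointwise_latticeable_nonconvergence:
  fixes f :: "'e::banach_lattice \<Rightarrow> 'f::banach"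
  assumes f: "homogeneous_type f"
    and A: "A \<subseteq> linf" "subsequence_invariant A" "linf_complete A"
    and \<tau>: "vector_topology \<tau>" "weaker_topology \<tau> euclidean"
    and D_subseq: "\<And>x r. x \<in> D \<Longrightarrow> strict_mono r \<Longrightarrow> x \<circ> r \<in> D"
    and D_scale: "\<And>x a. x \<in> D \<Longrightarrow> (\<And>k. 0 \<le> x k) \<Longrightarrow> (\<lambda>k. a k *\<^sub>R x k) \<in> D"
    and C: "C = {x \<in> A. x \<in> D \<and> \<not> limitin \<tau> (\<lambda>j. f (x j)) 0 sequentially}"
    and ne: "C \<inter> {x \<in> linf. 0 \<le> x} \<noteq> {}"
  shows "almost_positive_pointwise_latticeable linf linf_norm C"
  unfolding almost_positive_pointwise_latticeable_def
proof (intro conjI ballI)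
  show "C \<subseteq> linf"
    using A C by auto
  show "C \<inter> {x \<in> linf. 0 \<le> x} \<noteq> {}"
    by (rule ne)
next
  fix x assume x: "x \<in> C \<inter> {x \<in> linf. 0 \<le> x}"
  then have xA: "x \<in> A" "x \<in> D" and x_pos: "\<And>j. 0 \<le> x j"
    and x_lim: "\<not> limitin \<tau> (\<lambda>j. f (x j)) 0 sequentially"
    by (auto simp: C le_fun_def)
  obtain U and r :: "nat \<Rightarrow> nat" where U: "openin \<tau> U" "0 \<in> U" and r: "strict_mono r"
    and avoid: "\<And>k. f (x (r k)) \<notin> U"
    using subsequence_avoiding_neighbourhood[OF \<tau>(1) x_lim] by blast
  have "open U"
    using \<tau>(2) U by (simp add: weaker_topology_def)
  then obtain \<delta> where \<delta>: "\<delta> > 0" "\<And>u. f u \<notin> U \<Longrightarrow> \<delta> \<le> norm u"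
    using homogeneous_type_bounded_below[OF f _ U(2)] by blast
  define z where "z = x \<circ> r"
  have zA: "z \<in> A" "z \<in> D" "z \<in> linf"
    using A xA r D_subseq by (auto simp: z_def subsequence_invariant_def)
  have z_pos: "0 \<le> z k" and z_avoid: "f (z k) \<notin> U" and z_low: "\<delta> \<le> norm (z k)" for k
    using x_pos avoid \<delta> by (auto simp: z_def)
  have z_nz: "z k \<noteq> 0" for k
    using z_low[of k] \<delta>(1) by auto
  \<comment> \<open>The rows of an enumeration of all pairs of naturals are infinitely many infinite blocks.\<close>
  define p :: "nat \<Rightarrow> nat" where "p = fst \<circ> prod_decode"
  have p_encode: "p (prod_encode (i, k)) = i" for i k
    by (simp add: p_def)
  then have p_surj: "surj p"
    by (rule surjI[where f = "\<lambda>i. prod_encode (i, 0)"])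
  have p_inf: "infinite {k. p k = i}" for i
  proof (rule infinite_super)
    show "range (\<lambda>k. prod_encode (i, k)) \<subseteq> {k. p k = i}"
      by (auto simp: p_encode)
    show "infinite (range (\<lambda>k. prod_encode (i, k)))"
      by (rule range_inj_infinite) (auto simp: inj_def)
  qed
  define Y where "Y = blockwise_multiples p z"
  have "y \<in> C" if y: "y \<in> Y" "y \<noteq> 0" for y
  proof -
    obtain a where y_linf: "y \<in> linf" and a: "\<And>k. y k = a (p k) *\<^sub>R z k"
      using y by (auto simp: Y_def blockwise_multiples_def)
    have y_eq: "y = (\<lambda>k. a (p k) *\<^sub>R z k)"
      using a by auto
    have "(\<lambda>k. a (p k)) \<in> linf"
      by (rule bounded_multipliers[OF y_linf a \<delta>(1) z_low])
    from bspec[OF bspec[OF A(3)[unfolded linf_complete_def] zA(1)] this]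
    have "y \<in> A"
      unfolding y_eq .
    moreover have "y \<in> D"
      unfolding y_eq by (rule D_scale[OF zA(2) z_pos])
    moreover obtain k where "y k \<noteq> 0"
      using y(2) by (auto simp: fun_eq_iff)
    then have "a (p k) \<noteq> 0"
      using a by auto
    then have "\<not> limitin \<tau> (\<lambda>k. f (y k)) 0 sequentially"
      unfolding y_eq
      using not_limitin_blockwise_multiple[where x = z, OF f \<tau>(1) U z_avoid p_inf] by blast
    ultimately show ?thesis
      by (simp add: C)
  qed
  moreover have "z \<in> Y"
    using zA(3) by (auto simp: Y_def blockwise_multiples_def intro!: exI[of _ "\<lambda>_. 1"])
  ultimately show "\<exists>Y. sublattice linf Y \<and>
      closedin (Metric_space.mtopology linf (seq_dist linf linf_norm)) Y \<and>
      infinite_dimensional Y \<and> Y \<subseteq> C \<union> {0} \<and> (\<exists>r. strict_mono r \<and> x \<circ> r \<in> Y)"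
    using sublattice_blockwise_multiples[of z p] closedin_blockwise_multiples[of z p]
      infinite_dimensional_blockwise_multiples[of z p] z_pos z_nz zA(3) p_surj r
    by (intro exI[of _ Y] conjI exI[of _ r]) (auto simp: Y_def z_def)
qed

theorem theorem4p2:
  fixes f :: "'e::banach_lattice \<Rightarrow> 'f::banach"
    and A C1 C2 :: "(nat \<Rightarrow> 'e) set"
    and \<tau> :: "'f topology"
  assumes "homogeneous_type f"
    and "A \<subseteq> linf" and "subsequence_invariant A" and "linf_complete A"
    and "vector_topology \<tau>" and "weaker_topology \<tau> euclidean"
    and "C1 = {x \<in> A. \<not> limitin \<tau> (\<lambda>j. f (x j)) 0 sequentially}"
    and "C2 = {x \<in> A. disjoint_sequence x \<and> \<not> limitin \<tau> (\<lambda>j. f (x j)) 0 sequentially}"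
  shows "\<forall>C \<in> {C1, C2}.
    C \<inter> {x \<in> linf. 0 \<le> x} = {} \<or> almost_positive_pointwise_latticeable linf linf_norm C"
proof -
  note nonconvergence = almost_positive_pointwise_latticeable_nonconvergence[OF assms(1-6)]
  have "C1 \<inter> {x \<in> linf. 0 \<le> x} \<noteq> {} \<Longrightarrow> almost_positive_pointwise_latticeable linf linf_norm C1"
    by (rule nonconvergence[where D = UNIV]) (auto simp: assms(7))
  moreover have "x \<circ> r \<in> Collect disjoint_sequence"
    if "x \<in> Collect disjoint_sequence" "strict_mono r" for x :: "nat \<Rightarrow> 'e" and r :: "nat \<Rightarrow> nat"
    using that by (auto simp: disjoint_sequence_def strict_mono_eq)
  then have "C2 \<inter> {x \<in> linf. 0 \<le> x} \<noteq> {} \<Longrightarrow> almost_positive_pointwise_latticeable linf linf_norm C2"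
    by (rule nonconvergence[where D = "Collect disjoint_sequence"])
      (auto simp: assms(8) intro: disjoint_sequence_scaleR)
  ultimately show ?thesis
    by blast
qed

end
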